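(* Let $\alpha,\lambda>0$, let $N\ge1$ be an integer, let $\hat{\mathbf{y}},\tilde{\mathbf{y}}\in\mathbb{R}^N$ be the network logit and the pseudo logit of one example in D2, and let $$\tilde{\mathbf{y}}'=\tilde{\mathbf{y}}-\lambda\alpha\,\sigma(\tilde{\mathbf{y}})+\lambda\alpha\,\sigma(\hat{\mathbf{y}})$$ be the pseudo logit after one D2 update. Then $\sum_{i=1}^N\tilde y_i'=\sum_{i=1}^N\tilde y_i$. Consequently $\sum_{i=1}^N\tilde y_i$ does not change after initialization during D2 training, whatever the (possibly varying) network logits $\hat{\mathbf{y}}$ are at the successive updates.
   Context: $\sigma:\mathbb{R}^N\to\mathbb{R}^N$ is the softmax function, $\sigma(\mathbf{y})_i=\exp(y_i)/\sum_{j=1}^N\exp(y_j)$. In the D2 (deep decipher) framework, each unlabeled example has a network logit $\hat{\mathbf{y}}$ (which changes during training as the network is trained) and a pseudo logit $\tilde{\mathbf{y}}\in\mathbb{R}^N$, an updatable variable. The pseudo logit is initialized once and then updated repeatedly by gradient descent with learning rate $\lambda$ on the loss, which gives the update rule $\tilde{\mathbf{y}}\leftarrow\tilde{\mathbf{y}}-\lambda\alpha\,\sigma(\tilde{\mathbf{y}})+\lambda\alpha\,\sigma(\hat{\mathbf{y}})$, where $\alpha$ is a hyperparameter of the loss. *)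

theory Defs
  imports "HOL-Analysis.Analysis"
begin

definition softmax :: "real ^ 'n \<Rightarrow> real ^ 'n"
  where "softmax y = (\<chi> i. exp (y $ i) / (\<Sum>j\<in>UNIV. exp (y $ j)))"

definition d2_update :: "real \<Rightarrow> real \<Rightarrow> real ^ 'n \<Rightarrow> real ^ 'n \<Rightarrow> real ^ 'n"
  where "d2_update \<alpha> lr yhat ytilde =
    ytilde - (lr * \<alpha>) *\<^sub>R softmax ytilde + (lr * \<alpha>) *\<^sub>R softmax yhat"

(* A training run of one example with T updates: ytilde 0 is the initial pseudo logit,
   and yhat t is the network logit at the moment of the update from step t to step t + 1.
   The network logits are unconstrained, so they may depend in any way on the earlier
   course of the training. *)
definition d2_run :: "real \<Rightarrow> real \<Rightarrow> nat \<Rightarrow> (nat \<Rightarrow> real ^ 'n) \<Rightarrow> (nat \<Rightarrow> real ^ 'n) \<Rightarrow> bool"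
  where "d2_run \<alpha> lr T yhat ytilde \<longleftrightarrow>
    (\<forall>t<T. ytilde (Suc t) = d2_update \<alpha> lr (yhat t) (ytilde t))"

end

theory Submission
  imports Defs
begin

text \<open>The entries of every softmax vector sum to 1, so an update takes total mass
  \<open>lr * \<alpha>\<close> from the pseudo logit and gives the same mass back
  (\<open>sum_d2_update\<close>). This balance does not depend on the network logit, so it survives
  any sequence of network logits by induction on the number of updates
  (\<open>sum_d2_run\<close>).\<close>

lemma sum_softmax:
  fixes y :: "real ^ 'n"
  shows "(\<Sum>i\<in>UNIV. softmax y $ i) = 1"
proof -
  \<comment> \<open>The normalizer must be nonzero to cancel against itself; the index type is
    finite and nonempty, which is where N \<ge> 1 enters.\<close>
  have "(\<Sum>j\<in>UNIV. exp (y $ j)) > 0"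
    by (intro sum_pos) auto
  then show ?thesis
    by (simp add: softmax_def flip: sum_divide_distrib)
qed

lemma sum_d2_update:
  fixes yhat ytilde :: "real ^ 'n"
  shows "(\<Sum>i\<in>UNIV. d2_update \<alpha> lr yhat ytilde $ i) = (\<Sum>i\<in>UNIV. ytilde $ i)"
  \<comment> \<open>Pulling the factor \<open>lr * \<alpha>\<close> out of both softmax sums leaves
    that factor once with each sign.\<close>
  by (simp add: d2_update_def sum.distrib sum_subtractf sum_softmax flip: sum_distrib_left)

lemma sum_d2_run:
  fixes yhat ytilde :: "nat \<Rightarrow> real ^ 'n"
  assumes "d2_run \<alpha> lr T yhat ytilde" and "t \<le> T"
  shows "(\<Sum>i\<in>UNIV. ytilde t $ i) = (\<Sum>i\<in>UNIV. ytilde 0 $ i)"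
  using assms(2)
proof (induction t)
  case (Suc t)
  \<comment> \<open>The bound \<open>Suc t \<le> T\<close> gives \<open>t < T\<close>, the range in
    which a run obeys the update rule.\<close>
  then have "ytilde (Suc t) = d2_update \<alpha> lr (yhat t) (ytilde t)"
    using assms(1) by (simp add: d2_run_def)
  with Suc show ?case
    by (simp add: sum_d2_update)
qed simp

theorem mainTheorem3:
  fixes \<alpha> lr :: real
  assumes "\<alpha> > 0" and "lr > 0"
  shows "(\<forall>yhat ytilde :: real ^ 'n.
            (\<Sum>i\<in>UNIV. d2_update \<alpha> lr yhat ytilde $ i) = (\<Sum>i\<in>UNIV. ytilde $ i))
       \<and> (\<forall>(T :: nat) (yhat :: nat \<Rightarrow> real ^ 'n) ytilde.
            d2_run \<alpha> lr T yhat ytilde \<longrightarrow>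
            (\<forall>t\<le>T. (\<Sum>i\<in>UNIV. ytilde t $ i) = (\<Sum>i\<in>UNIV. ytilde 0 $ i)))"
  using sum_d2_update sum_d2_run by blast

end
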